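(* Let $0<q<1$ and let $\alpha,\beta,\delta$ be complex parameters. For $f_1\in V_{N-1}$, $f_2\in V_N$, $N\ge 1$, we have $$\langle\mathcal{R}_{N-1}f_1,f_2\rangle_{V_N}=\langle f_1,\mathcal{L}_Nf_2\rangle_{V_{N-1}},$$ that is, $\mathcal{L}_N$ is the adjoint of $\mathcal{R}_{N-1}$.
   Context: $V_N$ is the space of all functions $f:\{0,1,\dotsc,N\}\to\mathbb{C}$, with the convention $f(-1)=f(N+1)=0$. Notation: $(a;q)_k=\prod_{i=0}^{k-1}(1-aq^i)$ and $(a_1,\dots,a_r;q)_k=\prod_i(a_i;q)_k$. The space $V_N$ is endowed with the scalar product $$\langle f_1,f_2\rangle_{V_N}=q^{N(N+1)/2}\frac{(\alpha\delta^{-1}q,\beta q;q)_N}{(q,\delta^{-1};q)_N}\sum_{x=0}^N\frac{(\alpha q,\beta\delta q, q^{-N},\delta q^{-N};q)_x}{(q,\alpha^{-1}\delta q^{-N},\beta^{-1}q^{-N},\delta q;q)_x}\cdot\frac{1-\delta q^{2x-N}}{(\alpha\beta q)^x(1-\delta q^{-N})}f_1(x)\overline{f_2(x)},$$ or, equivalently, $$\langle f_1,f_2\rangle_{V_N}=\sum_{x=0}^N\frac{(\alpha q,\beta^{-1}\delta^{-1} q^{-x};q)_x(\beta q,\alpha\delta^{-1}q;q)_{N-x}} {(q;q)_x(q;q)_{N-x}(\delta^{-1} q^{-x};q)_{N+1}}\,\beta^x q^{N(N+1)/2+x}(1-\delta^{-1} q^{N-2x})f_1(x)\overline{f_2(x)}.$$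 The operators $\mathcal{R}_N:V_N\to V_{N+1}$ and $\mathcal{L}_N:V_N\to V_{N-1}$ are $$\mathcal{R}_N f(x)=-\frac{(1-q^{x-N-1})(1-\delta q^{x-N-1})}{1-\delta q^{2x-N-1}}f(x)+\frac{q^{-N-1}(1-q^x)(1-\delta q^x)}{1-\delta q^{2x-N-1}}f(x-1),$$ $$\mathcal{L}_N f(x)=-\frac{(\alpha-\delta q^{x-N})(\beta q^{N+1}-q^{x+1})}{1-\delta q^{2x-N+1}}f(x)+\frac{(1-\alpha q^{x+1})(1-\beta\delta q^{x+1})}{1-\delta q^{2x-N+1}}f(x+1).$$
   Formalization: For nonreal parameters the identity can fail (e.g. N=1, q=1/2, α=i, β=1, δ=−1); it is proved when the forms on all V_M are Hermitian (e.g. real α,β,δ), and for all complex parameters with α,β,δ conjugated in L_N; β,δ≠0 and δ≠q^k for |k|≤N are assumed so that the formulas are defined. *)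

theory Defs
  imports "HOL-Analysis.Analysis"
begin

definition qpoch :: "complex \<Rightarrow> complex \<Rightarrow> nat \<Rightarrow> complex" where
  "qpoch a q k = (\<Prod>i<k. 1 - a * q ^ i)"

text \<open>
  A function on \<open>{0,\<dots>,N}\<close> is represented by its extension by zero to all integers, which
  contains the convention \<open>f(-1) = f(N+1) = 0\<close>.
\<close>

definition V :: "nat \<Rightarrow> (int \<Rightarrow> complex) set" where
  "V N = {f. \<forall>x. x \<notin> {0..int N} \<longrightarrow> f x = 0}"

text \<open>
  The scalar product is defined by the second of its two equivalent formulas, which has fewer
  denominators; \<open>ip_eq_ip_hyp\<close> below shows that it agrees with the first one, \<open>ip_hyp\<close>,
  whenever the denominators of the latter are nonzero.
\<close>

definition weight :: "complex \<Rightarrow> complex \<Rightarrow> complex \<Rightarrow> complex \<Rightarrow> nat \<Rightarrow> nat \<Rightarrow> complex" where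
  "weight q \<alpha> \<beta> \<delta> N x =
     qpoch (\<alpha> * q) q x * qpoch (inverse \<beta> * inverse \<delta> * q powi (- int x)) q x *
     qpoch (\<beta> * q) q (N - x) * qpoch (\<alpha> * inverse \<delta> * q) q (N - x) /
     (qpoch q q x * qpoch q q (N - x) * qpoch (inverse \<delta> * q powi (- int x)) q (N + 1)) *
     \<beta> ^ x * q ^ (N * (N + 1) div 2 + x) * (1 - inverse \<delta> * q powi (int N - 2 * int x))"

definition ip ::
  "complex \<Rightarrow> complex \<Rightarrow> complex \<Rightarrow> complex \<Rightarrow> nat \<Rightarrow> (int \<Rightarrow> complex) \<Rightarrow> (int \<Rightarrow> complex) \<Rightarrow> complex" where
  "ip q \<alpha> \<beta> \<delta> N f1 f2 = (\<Sum>x=0..N. weight q \<alpha> \<beta> \<delta> N x * f1 (int x) * cnj (f2 (int x)))"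

definition ip_hyp ::
  "complex \<Rightarrow> complex \<Rightarrow> complex \<Rightarrow> complex \<Rightarrow> nat \<Rightarrow> (int \<Rightarrow> complex) \<Rightarrow> (int \<Rightarrow> complex) \<Rightarrow> complex" where
  "ip_hyp q \<alpha> \<beta> \<delta> N f1 f2 =
     q ^ (N * (N + 1) div 2) *
     (qpoch (\<alpha> * inverse \<delta> * q) q N * qpoch (\<beta> * q) q N / (qpoch q q N * qpoch (inverse \<delta>) q N)) *
     (\<Sum>x=0..N.
        qpoch (\<alpha> * q) q x * qpoch (\<beta> * \<delta> * q) q x *
        qpoch (q powi (- int N)) q x * qpoch (\<delta> * q powi (- int N)) q x /
        (qpoch q q x * qpoch (inverse \<alpha> * \<delta> * q powi (- int N)) q x *
         qpoch (inverse \<beta> * q powi (- int N)) q x * qpoch (\<delta> * q) q x) *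
        ((1 - \<delta> * q powi (2 * int x - int N)) /
         ((\<alpha> * \<beta> * q) ^ x * (1 - \<delta> * q powi (- int N)))) *
        f1 (int x) * cnj (f2 (int x)))"

text \<open>
  For nonreal parameters \<open>ip\<close> is sesquilinear but in general not conjugate symmetric, so that being a
  scalar product restricts \<open>\<alpha>\<close>, \<open>\<beta>\<close>, \<open>\<delta>\<close>.  Real parameters are always admissible
  (\<open>hermitian_on_ip_real\<close>).
\<close>

definition hermitian_on ::
  "(int \<Rightarrow> complex) set \<Rightarrow> ((int \<Rightarrow> complex) \<Rightarrow> (int \<Rightarrow> complex) \<Rightarrow> complex) \<Rightarrow> bool" where
  "hermitian_on W B \<longleftrightarrow> (\<forall>f\<in>W. \<forall>g\<in>W. B g f = cnj (B f g))"

text \<open>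
  The operators are cut off outside \<open>{0,\<dots>,N+1}\<close> and \<open>{0,\<dots>,N-1}\<close>.  For \<open>L_op\<close> this matters: its
  formula need not vanish at \<open>x = -1\<close> and \<open>x = N\<close>.  For \<open>N = 0\<close> the target of \<open>L_op\<close> is the zero space.
\<close>

definition R_op :: "complex \<Rightarrow> complex \<Rightarrow> nat \<Rightarrow> (int \<Rightarrow> complex) \<Rightarrow> (int \<Rightarrow> complex)" where
  "R_op q \<delta> N f x =
     (if x \<in> {0..int N + 1} then
        - ((1 - q powi (x - int N - 1)) * (1 - \<delta> * q powi (x - int N - 1)) /
            (1 - \<delta> * q powi (2 * x - int N - 1))) * f x
        + q powi (- int N - 1) * (1 - q powi x) * (1 - \<delta> * q powi x) /
            (1 - \<delta> * q powi (2 * x - int N - 1)) * f (x - 1)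
      else 0)"

definition L_op ::
  "complex \<Rightarrow> complex \<Rightarrow> complex \<Rightarrow> complex \<Rightarrow> nat \<Rightarrow> (int \<Rightarrow> complex) \<Rightarrow> (int \<Rightarrow> complex)" where
  "L_op q \<alpha> \<beta> \<delta> N f x =
     (if x \<in> {0..int N - 1} then
        - ((\<alpha> - \<delta> * q powi (x - int N)) * (\<beta> * q powi (int N + 1) - q powi (x + 1)) /
            (1 - \<delta> * q powi (2 * x - int N + 1))) * f x
        + (1 - \<alpha> * q powi (x + 1)) * (1 - \<beta> * \<delta> * q powi (x + 1)) /
            (1 - \<delta> * q powi (2 * x - int N + 1)) * f (x + 1)
      else 0)"

lemma R_op_in_V: "R_op q \<delta> N f \<in> V (N + 1)"
  by (auto simp: R_op_def V_def)

lemma L_op_in_V: "L_op q \<alpha> \<beta> \<delta> N f \<in> V (N - 1)"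
  by (auto simp: L_op_def V_def)

lemma cnj_qpoch: "cnj (qpoch a q k) = qpoch (cnj a) (cnj q) k"
  by (simp add: qpoch_def)

lemma cnj_powi: "cnj (z powi n) = cnj z powi n"
  by (simp add: power_int_def)

lemma cnj_weight: "cnj (weight q \<alpha> \<beta> \<delta> N x) = weight (cnj q) (cnj \<alpha>) (cnj \<beta>) (cnj \<delta>) N x"
  by (simp add: weight_def cnj_qpoch cnj_powi)

lemma hermitian_on_ip_real:
  assumes "q \<in> \<real>" "\<alpha> \<in> \<real>" "\<beta> \<in> \<real>" "\<delta> \<in> \<real>"
  shows "hermitian_on (V N) (ip q \<alpha> \<beta> \<delta> N)"
proof -
  have "cnj (weight q \<alpha> \<beta> \<delta> N x) = weight q \<alpha> \<beta> \<delta> N x" for x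
    using assms by (simp add: cnj_weight Reals_cnj_iff)
  then show ?thesis
    by (simp add: hermitian_on_def ip_def mult_ac)
qed

lemma qpoch_0 [simp]: "qpoch a q 0 = 1"
  by (simp add: qpoch_def)

lemma qpoch_Suc: "qpoch a q (Suc k) = qpoch a q k * (1 - a * q ^ k)"
  by (simp add: qpoch_def)

lemma qpoch_Suc_shift: "qpoch a q (Suc k) = (1 - a) * qpoch (a * q) q k"
  by (simp add: qpoch_def prod.lessThan_Suc_shift mult_ac del: prod.lessThan_Suc)

lemma ratio_aux:
  fixes S :: complex
  assumes "X * (g * a) * rD = Y * b * rN * h"
    and "g \<noteq> 0" "h \<noteq> 0" "E \<noteq> 0" "b \<noteq> 0" "a \<noteq> 0" "rD \<noteq> 0"
  shows "S * (X / (h * E)) = S * (Y / (g * (E * a / b))) * (rN / rD)"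
proof -
  have "X / (h * E) = Y / (g * (E * a / b)) * (rN / rD)"
    using assms by (simp add: frac_eq_eq) (simp add: mult_ac)
  then show ?thesis by (simp add: mult.assoc)
qed

lemma ip_eq_ip_hyp:
  fixes q :: real and \<alpha> \<beta> \<delta> :: complex
  assumes q: "0 < q" "q < 1" and nz: "\<alpha> \<noteq> 0" "\<beta> \<noteq> 0" "\<delta> \<noteq> 0"
    and \<delta>: "\<forall>k\<in>{- int N..int N}. \<delta> \<noteq> complex_of_real q powi k"
    and \<alpha>\<beta>: "\<forall>k\<in>{1..N}. \<beta> * q ^ k \<noteq> 1 \<and> \<alpha> * q ^ k \<noteq> \<delta>"
  shows "ip q \<alpha> \<beta> \<delta> N = ip_hyp q \<alpha> \<beta> \<delta> N"
proof -
  define p where "p = complex_of_real q"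
  define P where "P = p ^ N"
  have p0: "p \<noteq> 0" using q by (simp add: p_def)
  have P0: "P \<noteq> 0" using p0 by (simp add: P_def)
  have p1: "p ^ Suc k \<noteq> 1" for k
  proof -
    have "q ^ Suc k < 1" using q by (intro power_Suc_less_one) auto
    then show ?thesis unfolding p_def by (metis less_irrefl of_real_eq_1_iff of_real_power)
  qed
  have \<delta>': "\<delta> \<noteq> p powi k" if "- int N \<le> k" "k \<le> int N" for k
    using \<delta> that by (auto simp: p_def)
  define T where "T x =
        qpoch (\<alpha> * p) p x * qpoch (\<beta> * \<delta> * p) p x *
        qpoch (p powi (- int N)) p x * qpoch (\<delta> * p powi (- int N)) p x /
        (qpoch p p x * qpoch (inverse \<alpha> * \<delta> * p powi (- int N)) p x *
         qpoch (inverse \<beta> * p powi (- int N)) p x * qpoch (\<delta> * p) p x) *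
        ((1 - \<delta> * p powi (2 * int x - int N)) /
         ((\<alpha> * \<beta> * p) ^ x * (1 - \<delta> * p powi (- int N))))" for x
  define K where "K = p ^ (N * (N + 1) div 2) *
     (qpoch (\<alpha> * inverse \<delta> * p) p N * qpoch (\<beta> * p) p N / (qpoch p p N * qpoch (inverse \<delta>) p N))"
  have key: "weight p \<alpha> \<beta> \<delta> N x = K * T x" if "x \<le> N" for x
    using that
  proof (induction x)
    case 0
    have "1 - \<delta> * p powi (- int N) \<noteq> 0"
      using \<delta>'[of "int N"] p0 by (auto simp: power_int_minus field_simps)
    moreover have "1 - inverse \<delta> * p ^ N \<noteq> 0"
      using \<delta>'[of "int N"] nz by (auto simp: field_simps)
    ultimately show ?case
      by (simp add: weight_def K_def T_def qpoch_Suc)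
  next
    case (Suc x)
    then have x: "x < N" by simp
    define Q where "Q = p ^ x"
    have Q0: "Q \<noteq> 0" using p0 by (simp add: Q_def)
    have pw: "p powi (- int N) = 1 / P" "p powi (- int x) = 1 / Q" "p powi (- int (Suc x)) = 1 / (p * Q)"
      "p powi (int N - 2 * int x) = P / Q\<^sup>2" "p powi (int N - 2 * int (Suc x)) = P / (p\<^sup>2 * Q\<^sup>2)"
      "p powi (2 * int x - int N) = Q\<^sup>2 / P" "p powi (2 * int (Suc x) - int N) = p\<^sup>2 * Q\<^sup>2 / P"
      using p0 by (simp_all add: P_def Q_def power_int_diff power_int_minus power_int_add power_int_mult
          power2_eq_square field_simps)
    obtain m where m: "N = x + Suc m" using x less_iff_Suc_add by auto
    have Nx: "N - x = Suc m" "N - Suc x = m" using m by auto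
    have pm: "p ^ m = P / (p * Q)" using m p0 by (simp add: P_def Q_def power_add)
    define E1 where "E1 = qpoch (inverse \<delta> * (1 / Q)) p (N + 1)"
    define E2 where "E2 = qpoch (inverse \<delta> * (1 / (p * Q))) p (N + 1)"
    have E: "E2 * (1 - inverse \<delta> * P / Q) = (1 - inverse \<delta> * (1 / (p * Q))) * E1"
    proof -
      have "qpoch (inverse \<delta> * (1 / (p * Q))) p (Suc (N + 1)) = E2 * (1 - inverse \<delta> * P / Q)"
        unfolding qpoch_Suc[of _ _ "N + 1"] E2_def using p0 by (simp add: P_def)
      moreover have "qpoch (inverse \<delta> * (1 / (p * Q))) p (Suc (N + 1)) = (1 - inverse \<delta> * (1 / (p * Q))) * E1"
        unfolding qpoch_Suc_shift E1_def using p0 by (simp add: field_simps)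
      ultimately show ?thesis by simp
    qed
    have E1_nz: "E1 \<noteq> 0" and E2_nz: "E2 \<noteq> 0"
    proof -
      have *: "1 - inverse \<delta> * (1 / p ^ y) * p ^ i \<noteq> 0" if "y \<le> N" "i < N + 1" for y i
      proof
        assume "1 - inverse \<delta> * (1 / p ^ y) * p ^ i = 0"
        then have "\<delta> = p ^ i / p ^ y" using nz p0 by (simp add: field_simps)
        also have "\<dots> = p powi (int i - int y)" using p0 by (simp add: power_int_diff)
        finally show False using \<delta>'[of "int i - int y"] that by simp
      qed
      show "E1 \<noteq> 0" using *[of x] x unfolding E1_def qpoch_def Q_def by (subst prod_zero_iff) auto
      show "E2 \<noteq> 0" using *[of "Suc x"] x unfolding E2_def qpoch_def Q_def power_Suc[symmetric] by (subst prod_zero_iff) (auto simp del: power_Suc)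
    qed
    have n1: "p * Q \<noteq> 1" using p1[of x] by (simp add: Q_def)
    have n2: "P \<noteq> Q" using p1[of m] p0 by (auto simp: P_def Q_def m power_add)
    have n3: "\<delta> * (p * Q) \<noteq> 1"
    proof
      assume "\<delta> * (p * Q) = 1"
      then have "\<delta> = p powi (- int (Suc x))" using p0 Q0 by (simp only: pw) (simp add: field_simps)
      then show False using \<delta>'[of "- int (Suc x)"] x by simp
    qed
    have n4: "\<delta> * Q \<noteq> P"
    proof
      assume "\<delta> * Q = P"
      then have "\<delta> = p powi (int N - int x)" using p0 Q0 by (simp add: power_int_diff P_def Q_def field_simps)
      then show False using \<delta>'[of "int N - int x"] x by simp
    qed
    have n5: "\<delta> * Q\<^sup>2 \<noteq> P"
    proof
      assume "\<delta> * Q\<^sup>2 = P"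
      then have "\<delta> = p powi (int N - 2 * int x)" using p0 Q0 by (simp only: pw) (simp add: field_simps)
      then show False using \<delta>'[of "int N - 2 * int x"] x by simp
    qed
    have Nx': "Suc m \<in> {1..N}" "p ^ Suc m * Q = P" using m by (auto simp: P_def Q_def power_add)
    have n6: "\<beta> * P \<noteq> Q" "\<alpha> * P \<noteq> \<delta> * Q"
      using \<alpha>\<beta>[rule_format, OF Nx'(1)] Q0
      unfolding Nx'(2)[symmetric] of_real_power p_def[symmetric] by auto
    have qp_nz: "qpoch p p k \<noteq> 0" for k using p1 by (simp add: qpoch_def)
    have w0: "weight p \<alpha> \<beta> \<delta> N x =
        qpoch (\<alpha> * p) p x * qpoch (inverse \<beta> * inverse \<delta> * (1 / Q)) p x *
        (qpoch (\<beta> * p) p m * (1 - \<beta> * (P / Q))) * (qpoch (\<alpha> * inverse \<delta> * p) p m * (1 - \<alpha> * inverse \<delta> * (P / Q))) /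
        (qpoch p p x * (qpoch p p m * (1 - P / Q)) * E1) *
        \<beta> ^ x * p ^ (N * (N + 1) div 2 + x) * (1 - inverse \<delta> * (P / Q\<^sup>2))"
      using p0 by (simp add: weight_def pw Nx qpoch_Suc pm E1_def)
    have w1: "weight p \<alpha> \<beta> \<delta> N (Suc x) =
        (qpoch (\<alpha> * p) p x * (1 - \<alpha> * p * Q)) *
        ((1 - inverse \<beta> * inverse \<delta> * (1 / (p * Q))) * qpoch (inverse \<beta> * inverse \<delta> * (1 / Q)) p x) *
        qpoch (\<beta> * p) p m * qpoch (\<alpha> * inverse \<delta> * p) p m /
        ((qpoch p p x * (1 - p * Q)) * qpoch p p m * E2) *
        (\<beta> * \<beta> ^ x) * (p * p ^ (N * (N + 1) div 2 + x)) * (1 - inverse \<delta> * (P / (p\<^sup>2 * Q\<^sup>2)))"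
    proof -
      have a: "qpoch (\<alpha> * p) p (Suc x) = qpoch (\<alpha> * p) p x * (1 - \<alpha> * p * Q)"
        "qpoch p p (Suc x) = qpoch p p x * (1 - p * Q)"
        by (simp_all add: qpoch_Suc Q_def)
      have b: "qpoch (inverse \<beta> * inverse \<delta> * (1 / (p * Q))) p (Suc x) =
          (1 - inverse \<beta> * inverse \<delta> * (1 / (p * Q))) * qpoch (inverse \<beta> * inverse \<delta> * (1 / Q)) p x"
        unfolding qpoch_Suc_shift using p0 by (simp add: field_simps)
      show ?thesis
        unfolding weight_def pw Nx a b E2_def[symmetric] by simp
    qed
    define rN where "rN = (1 - \<alpha> * p * Q) * (1 - \<beta> * \<delta> * p * Q) * (1 - Q / P) * (1 - \<delta> * Q / P) * (1 - \<delta> * (p\<^sup>2 * Q\<^sup>2 / P))"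
    define rD where "rD = (1 - p * Q) * (1 - inverse \<alpha> * \<delta> * Q / P) * (1 - inverse \<beta> * Q / P) * (1 - \<delta> * p * Q) * (\<alpha> * \<beta> * p) * (1 - \<delta> * (Q\<^sup>2 / P))"
    have rD: "rD \<noteq> 0"
    proof -
      have "1 - p * Q \<noteq> 0" "1 - \<delta> * p * Q \<noteq> 0" "1 - \<delta> * (Q\<^sup>2 / P) \<noteq> 0" "\<alpha> * \<beta> * p \<noteq> 0"
        "1 - inverse \<alpha> * \<delta> * Q / P \<noteq> 0" "1 - inverse \<beta> * Q / P \<noteq> 0"
        using n1 n3 n5 n6 nz p0 P0 by (auto simp: field_simps)
      then show ?thesis unfolding rD_def by simp
    qed
    have T: "T (Suc x) = T x * (rN / rD)"
    proof -
      have "1 - \<delta> * (Q\<^sup>2 / P) \<noteq> 0" using n5 P0 by (auto simp: field_simps)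
      then show ?thesis
        unfolding T_def pw qpoch_Suc rN_def rD_def Q_def[symmetric] power_Suc using n5 P0 by (simp add: mult_ac)
    qed
    have w: "weight p \<alpha> \<beta> \<delta> N (Suc x) = weight p \<alpha> \<beta> \<delta> N x * (rN / rD)"
    proof -
      define S where "S = qpoch (\<alpha> * p) p x * qpoch (inverse \<beta> * inverse \<delta> * (1 / Q)) p x *
        qpoch (\<beta> * p) p m * qpoch (\<alpha> * inverse \<delta> * p) p m / (qpoch p p x * qpoch p p m) *
        \<beta> ^ x * p ^ (N * (N + 1) div 2 + x)"
      have w0': "weight p \<alpha> \<beta> \<delta> N x = S * ((1 - \<beta> * (P / Q)) * (1 - \<alpha> * inverse \<delta> * (P / Q)) * (1 - inverse \<delta> * (P / Q\<^sup>2))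
          / ((1 - P / Q) * E1))"
        unfolding w0 S_def by (simp add: mult_ac)
      have w1': "weight p \<alpha> \<beta> \<delta> N (Suc x) = S * ((1 - \<alpha> * p * Q) * (1 - inverse \<beta> * inverse \<delta> * (1 / (p * Q))) * \<beta> * p
          * (1 - inverse \<delta> * (P / (p\<^sup>2 * Q\<^sup>2))) / ((1 - p * Q) * E2))"
        unfolding w1 S_def by (simp add: mult_ac)
      have d1: "1 - inverse \<delta> * (1 / (p * Q)) \<noteq> 0" using n3 nz p0 Q0 by (auto simp: field_simps)
      have d2: "1 - inverse \<delta> * P / Q \<noteq> 0" using n4 nz Q0 by (auto simp: field_simps)
      have E1: "E1 = E2 * (1 - inverse \<delta> * P / Q) / (1 - inverse \<delta> * (1 / (p * Q)))"
        using E d1 by (simp add: field_simps)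
      have "(1 - \<alpha> * p * Q) * (1 - inverse \<beta> * inverse \<delta> * (1 / (p * Q))) * \<beta> * p * (1 - inverse \<delta> * (P / (p\<^sup>2 * Q\<^sup>2)))
            * ((1 - P / Q) * (1 - inverse \<delta> * P / Q)) * rD
          = (1 - \<beta> * (P / Q)) * (1 - \<alpha> * inverse \<delta> * (P / Q)) * (1 - inverse \<delta> * (P / Q\<^sup>2))
            * (1 - inverse \<delta> * (1 / (p * Q))) * rN * (1 - p * Q)"
      proof -
        have f: "1 - inverse \<beta> * inverse \<delta> * (1 / (p * Q)) = (\<beta> * \<delta> * p * Q - 1) / (\<beta> * \<delta> * p * Q)"
          "1 - inverse \<delta> * (P / (p\<^sup>2 * Q\<^sup>2)) = (\<delta> * p\<^sup>2 * Q\<^sup>2 - P) / (\<delta> * p\<^sup>2 * Q\<^sup>2)"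
          "1 - P / Q = (Q - P) / Q" "1 - inverse \<delta> * P / Q = (\<delta> * Q - P) / (\<delta> * Q)"
          "1 - inverse \<alpha> * \<delta> * Q / P = (\<alpha> * P - \<delta> * Q) / (\<alpha> * P)"
          "1 - inverse \<beta> * Q / P = (\<beta> * P - Q) / (\<beta> * P)"
          "1 - \<delta> * (Q\<^sup>2 / P) = (P - \<delta> * Q\<^sup>2) / P"
          "1 - \<beta> * (P / Q) = (Q - \<beta> * P) / Q"
          "1 - \<alpha> * inverse \<delta> * (P / Q) = (\<delta> * Q - \<alpha> * P) / (\<delta> * Q)"
          "1 - inverse \<delta> * (P / Q\<^sup>2) = (\<delta> * Q\<^sup>2 - P) / (\<delta> * Q\<^sup>2)"
          "1 - inverse \<delta> * (1 / (p * Q)) = (\<delta> * p * Q - 1) / (\<delta> * p * Q)"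
          "1 - Q / P = (P - Q) / P" "1 - \<delta> * Q / P = (P - \<delta> * Q) / P"
          "1 - \<delta> * (p\<^sup>2 * Q\<^sup>2 / P) = (P - \<delta> * p\<^sup>2 * Q\<^sup>2) / P"
          using nz p0 P0 Q0 by (simp_all add: field_simps)
        have g: "Q - P = - (P - Q)" "\<delta> * Q - P = - (P - \<delta> * Q)" "\<delta> * p\<^sup>2 * Q\<^sup>2 - P = - (P - \<delta> * p\<^sup>2 * Q\<^sup>2)"
          "\<delta> * Q\<^sup>2 - P = - (P - \<delta> * Q\<^sup>2)" "\<beta> * \<delta> * p * Q - 1 = - (1 - \<beta> * \<delta> * p * Q)"
          "\<delta> * p * Q - 1 = - (1 - \<delta> * p * Q)" "Q - \<beta> * P = - (\<beta> * P - Q)"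
          "\<delta> * Q - \<alpha> * P = - (\<alpha> * P - \<delta> * Q)"
          by simp_all
        define u1 u2 u3 u4 u5 u6 u7 u8 u9 u10 where u: "u1 = P - Q" "u2 = P - \<delta> * Q" "u3 = P - \<delta> * p\<^sup>2 * Q\<^sup>2"
          "u4 = P - \<delta> * Q\<^sup>2" "u5 = 1 - \<beta> * \<delta> * p * Q" "u6 = 1 - \<delta> * p * Q" "u7 = \<beta> * P - Q"
          "u8 = \<alpha> * P - \<delta> * Q" "u9 = 1 - \<alpha> * p * Q" "u10 = 1 - p * Q"
        show ?thesis
          unfolding rD_def rN_def f g u[symmetric] using nz p0 P0 Q0
          by (simp add: divide_simps power2_eq_square)
      qed
      moreover have "1 - P / Q \<noteq> 0" "1 - p * Q \<noteq> 0" using n1 n2 Q0 by auto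
      ultimately show ?thesis
        unfolding w0' w1' E1 using E2_nz d1 d2 rD by (intro ratio_aux)
    qed
    show ?case using Suc x by (simp add: T w)
  qed
  have "ip p \<alpha> \<beta> \<delta> N f1 f2 = ip_hyp p \<alpha> \<beta> \<delta> N f1 f2" for f1 f2
    unfolding ip_def ip_hyp_def K_def[symmetric] T_def[symmetric]
    by (auto simp: key sum_distrib_left mult.assoc intro!: sum.cong)
  then show ?thesis
    by (auto simp: p_def fun_eq_iff)
qed

end

theory Submission
  imports Defs
begin

text \<open>
  Both sides are bilinear in \<open>f1\<close> and \<open>cnj f2\<close> with bidiagonal matrices, so the second identity amounts
  to two relations between neighbouring weights, each a ratio of \<open>q\<close>-shifted factorials.  For the first
  identity the products of weights and matrix entries must be real.  Hermitian forms have real weights,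
  and the entries of \<open>R_op\<close> are real if \<open>\<delta>\<close> is; also \<open>R_diag\<close> at \<open>0\<close> and \<open>R_sub\<close> at \<open>N + 1\<close> are always
  real, because their \<open>\<delta>\<close>-dependent factors cancel.  If \<open>\<delta>\<close> is not real, then reality of the weights for
  \<open>M = 1, 2\<close> forces all weights at interior points to vanish, so only these boundary entries matter.
\<close>

section \<open>Matrix entries of the two operators\<close>

text \<open>The four entries leave out the cut-off: inside the range they are the coefficients
  themselves, and conjugating them merely conjugates the parameters.\<close>

definition R_diag :: "complex \<Rightarrow> complex \<Rightarrow> nat \<Rightarrow> int \<Rightarrow> complex" where
  "R_diag q \<delta> N x = - ((1 - q powi (x - int N - 1)) * (1 - \<delta> * q powi (x - int N - 1)) /
     (1 - \<delta> * q powi (2 * x - int N - 1)))"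

definition R_sub :: "complex \<Rightarrow> complex \<Rightarrow> nat \<Rightarrow> int \<Rightarrow> complex" where
  "R_sub q \<delta> N x = q powi (- int N - 1) * (1 - q powi x) * (1 - \<delta> * q powi x) /
     (1 - \<delta> * q powi (2 * x - int N - 1))"

definition L_diag :: "complex \<Rightarrow> complex \<Rightarrow> complex \<Rightarrow> complex \<Rightarrow> nat \<Rightarrow> int \<Rightarrow> complex" where
  "L_diag q \<alpha> \<beta> \<delta> N x = - ((\<alpha> - \<delta> * q powi (x - int N)) *
     (\<beta> * q powi (int N + 1) - q powi (x + 1)) / (1 - \<delta> * q powi (2 * x - int N + 1)))"

definition L_super :: "complex \<Rightarrow> complex \<Rightarrow> complex \<Rightarrow> complex \<Rightarrow> nat \<Rightarrow> int \<Rightarrow> complex" where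
  "L_super q \<alpha> \<beta> \<delta> N x = (1 - \<alpha> * q powi (x + 1)) * (1 - \<beta> * \<delta> * q powi (x + 1)) /
     (1 - \<delta> * q powi (2 * x - int N + 1))"

lemma R_op_eq:
  "x \<in> {0..int N + 1} \<Longrightarrow> R_op q \<delta> N f x = R_diag q \<delta> N x * f x + R_sub q \<delta> N x * f (x - 1)"
  by (simp add: R_op_def R_diag_def R_sub_def)

lemma L_op_eq:
  "x \<in> {0..int N - 1} \<Longrightarrow>
     L_op q \<alpha> \<beta> \<delta> N f x = L_diag q \<alpha> \<beta> \<delta> N x * f x + L_super q \<alpha> \<beta> \<delta> N x * f (x + 1)"
  by (simp add: L_op_def L_diag_def L_super_def)

lemma cnj_L_diag:
  "cnj (L_diag q \<alpha> \<beta> \<delta> N x) = L_diag (cnj q) (cnj \<alpha>) (cnj \<beta>) (cnj \<delta>) N x"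
  by (simp add: L_diag_def cnj_powi)

lemma cnj_L_super:
  "cnj (L_super q \<alpha> \<beta> \<delta> N x) = L_super (cnj q) (cnj \<alpha>) (cnj \<beta>) (cnj \<delta>) N x"
  by (simp add: L_super_def cnj_powi)

section \<open>Relations between neighbouring weights\<close>

text \<open>Raising \<open>n\<close> at fixed \<open>x\<close> appends one factor to each symbol of
  length \<open>n - x\<close> and to the one of length \<open>n + 1\<close>. Besides these, only the
  power of \<open>p\<close> and the final linear factor change. The common part \<open>S\<close>
  cancels, leaving a rational identity in \<open>Q = p ^ x\<close> and
  \<open>P = p ^ m\<close>.\<close>

lemma weight_R_diag:
  fixes p :: complex
  assumes p0: "p \<noteq> 0" and p1: "\<And>k. p ^ Suc k \<noteq> 1" and \<delta>0: "\<delta> \<noteq> 0"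
    and \<delta>: "\<And>k. - int n - 1 \<le> k \<Longrightarrow> k \<le> int n + 1 \<Longrightarrow> \<delta> \<noteq> p powi k" and x: "x \<le> n"
  shows "weight p \<alpha> \<beta> \<delta> (Suc n) x * R_diag p \<delta> n (int x) =
         weight p \<alpha> \<beta> \<delta> n x * L_diag p \<alpha> \<beta> \<delta> (Suc n) (int x)"
proof -
  obtain m where m: "n = x + m" using x le_Suc_ex by blast
  define Q P where "Q = p ^ x" and "P = p ^ m"
  have Q0: "Q \<noteq> 0" "P \<noteq> 0" using p0 by (simp_all add: Q_def P_def)
  have pw: "p powi (- int x) = 1 / Q" "p powi (int x - int n - 1) = 1 / (p * P)"
    "p powi (2 * int x - int n - 1) = Q / (p * P)" "p powi (int x - int (Suc n)) = 1 / (p * P)"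
    "p powi (int (Suc n) + 1) = p * p * P * Q" "p powi (int x + 1) = p * Q"
    "p powi (2 * int x - int (Suc n) + 1) = Q / P" "p powi (int n - 2 * int x) = P / Q"
    "p powi (int (Suc n) - 2 * int x) = p * P / Q"
    using p0 by (simp_all add: m P_def Q_def power_int_diff power_int_minus power_int_add power_int_mult
        power2_eq_square field_simps)
  have Nx: "Suc n - x = Suc m" "n - x = m" using m by auto
  \<comment> \<open>The growth of the triangular number by \<open>Suc n\<close> is the source of the
    factor \<open>p * P * Q\<close> in \<open>w1\<close>.\<close>
  have tri: "Suc n * (Suc n + 1) div 2 + x = (n * (n + 1) div 2 + x) + Suc n" by simp
  define E where "E = qpoch (inverse \<delta> * (1 / Q)) p (n + 1)"
  have E': "qpoch (inverse \<delta> * (1 / Q)) p (Suc n + 1) = E * (1 - inverse \<delta> * p * P)"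
    using p0 by (simp add: E_def qpoch_Suc m P_def Q_def power_add)
  have n1: "p * P \<noteq> 1" using p1[of m] by (simp add: P_def)
  have n2: "\<delta> \<noteq> p * P" using \<delta>[of "int (Suc m)"] by (simp add: m P_def del: of_nat_Suc)
  have n3: "\<delta> * Q \<noteq> p * P"
    using \<delta>[of "int (Suc m) - int x"] p0 by (auto simp: m P_def Q_def power_int_diff field_simps simp del: of_nat_Suc)
  have n4: "\<delta> * Q \<noteq> P"
    using \<delta>[of "int m - int x"] p0 by (auto simp: m P_def Q_def power_int_diff field_simps)
  define S where "S = qpoch (\<alpha> * p) p x * qpoch (inverse \<beta> * inverse \<delta> * (1 / Q)) p x *
     qpoch (\<beta> * p) p m * qpoch (\<alpha> * inverse \<delta> * p) p m / (qpoch p p x * qpoch p p m * E) *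
     \<beta> ^ x * p ^ (n * (n + 1) div 2 + x)"
  have w0: "weight p \<alpha> \<beta> \<delta> n x = S * (1 - inverse \<delta> * (P / Q))"
    by (simp add: weight_def pw Nx S_def E_def)
  have w1: "weight p \<alpha> \<beta> \<delta> (Suc n) x = S *
     ((1 - \<beta> * p * P) * (1 - \<alpha> * inverse \<delta> * p * P) / ((1 - p * P) * (1 - inverse \<delta> * p * P))
      * (p * P * Q) * (1 - inverse \<delta> * (p * P / Q)))"
    unfolding weight_def pw Nx tri E' qpoch_Suc S_def P_def[symmetric] power_add[of p _ "Suc n"]
    by (simp add: m power_add P_def Q_def mult_ac)
  have "(1 - \<beta> * p * P) * (1 - \<alpha> * inverse \<delta> * p * P) / ((1 - p * P) * (1 - inverse \<delta> * p * P))
      * (p * P * Q) * (1 - inverse \<delta> * (p * P / Q)) * R_diag p \<delta> n (int x) =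
     (1 - inverse \<delta> * (P / Q)) * L_diag p \<alpha> \<beta> \<delta> (Suc n) (int x)"
  proof -
    have f: "1 - inverse \<delta> * (P / Q) = (\<delta> * Q - P) / (\<delta> * Q)"
      "1 - inverse \<delta> * (p * P / Q) = (\<delta> * Q - p * P) / (\<delta> * Q)"
      "1 - inverse \<delta> * p * P = (\<delta> - p * P) / \<delta>"
      "1 - \<alpha> * inverse \<delta> * p * P = (\<delta> - \<alpha> * p * P) / \<delta>"
      "1 - 1 / (p * P) = - (1 - p * P) / (p * P)" "1 - \<delta> * (1 / (p * P)) = - (\<delta> - p * P) / (p * P)"
      "1 - \<delta> * (Q / (p * P)) = - (\<delta> * Q - p * P) / (p * P)"
      "\<alpha> - \<delta> * (1 / (p * P)) = - (\<delta> - \<alpha> * p * P) / (p * P)"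
      "\<beta> * (p * p * P * Q) - p * Q = - (1 - \<beta> * p * P) * (p * Q)"
      "1 - \<delta> * (Q / P) = - (\<delta> * Q - P) / P"
      using p0 Q0 \<delta>0 by (simp_all add: field_simps)
    \<comment> \<open>With each linear factor replaced by one letter, both sides are quotients of
      monomials and the identity is pure cancellation.\<close>
    define u1 u2 u3 u4 u5 u6 where u: "u1 = \<delta> * Q - P" "u2 = \<delta> * Q - p * P" "u3 = \<delta> - p * P"
      "u4 = \<delta> - \<alpha> * p * P" "u5 = 1 - p * P" "u6 = 1 - \<beta> * p * P"
    have "u1 \<noteq> 0" "u2 \<noteq> 0" "u3 \<noteq> 0" "u5 \<noteq> 0" using n1 n2 n3 n4 by (auto simp: u)
    then show ?thesis
      unfolding R_diag_def L_diag_def pw f u[symmetric] using p0 Q0 \<delta>0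
      by (simp add: divide_simps)
  qed
  then show ?thesis unfolding w0 w1 by (simp only: mult.assoc)
qed

text \<open>Raising \<open>n\<close> and \<open>x\<close> together keeps \<open>n - x\<close> fixed.
  The symbols whose base contains the power with exponent \<open>- x\<close> have that base divided
  by \<open>p\<close>, so they gain their new factor at the front, while the other symbols of length
  \<open>x\<close> gain it at the end.\<close>

lemma weight_R_sub:
  fixes p :: complex
  assumes p0: "p \<noteq> 0" and p1: "\<And>k. p ^ Suc k \<noteq> 1" and \<beta>0: "\<beta> \<noteq> 0" and \<delta>0: "\<delta> \<noteq> 0"
    and \<delta>: "\<And>k. - int n - 1 \<le> k \<Longrightarrow> k \<le> int n + 1 \<Longrightarrow> \<delta> \<noteq> p powi k" and x: "x \<le> n"
  shows "weight p \<alpha> \<beta> \<delta> (Suc n) (Suc x) * R_sub p \<delta> n (int (Suc x)) =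
         weight p \<alpha> \<beta> \<delta> n x * L_super p \<alpha> \<beta> \<delta> (Suc n) (int x)"
proof -
  obtain m where m: "n = x + m" using x le_Suc_ex by blast
  define Q P where "Q = p ^ x" and "P = p ^ m"
  have Q0: "Q \<noteq> 0" "P \<noteq> 0" using p0 by (simp_all add: Q_def P_def)
  have pw: "p powi (- int x) = 1 / Q" "p powi (- int (Suc x)) = 1 / (p * Q)"
    "p powi (- int n - 1) = 1 / (p * P * Q)" "p powi (int (Suc x)) = p * Q"
    "p powi (2 * int (Suc x) - int n - 1) = p * Q / P" "p powi (int x + 1) = p * Q"
    "p powi (2 * int x - int (Suc n) + 1) = Q / P" "p powi (int n - 2 * int x) = P / Q"
    "p powi (int (Suc n) - 2 * int (Suc x)) = P / (p * Q)"
    using p0 by (simp_all add: m P_def Q_def power_int_diff power_int_minus power_int_add power_int_mult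
        power2_eq_square field_simps)
  have Nx: "Suc n - Suc x = m" "n - x = m" using m by auto
  \<comment> \<open>The exponent grows by \<open>n + 2\<close>: by \<open>n + 1\<close> from the
    triangular number and by one from \<open>x\<close>.\<close>
  have tri: "Suc n * (Suc n + 1) div 2 + Suc x = (n * (n + 1) div 2 + x) + Suc (Suc n)" by simp
  define E where "E = qpoch (inverse \<delta> * (1 / Q)) p (n + 1)"
  have E': "qpoch (inverse \<delta> * (1 / (p * Q))) p (Suc n + 1) = (1 - inverse \<delta> * (1 / (p * Q))) * E"
    using p0 by (simp add: E_def qpoch_Suc_shift)
  have b: "qpoch (inverse \<beta> * inverse \<delta> * (1 / (p * Q))) p (Suc x) =
      (1 - inverse \<beta> * inverse \<delta> * (1 / (p * Q))) * qpoch (inverse \<beta> * inverse \<delta> * (1 / Q)) p x"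
    unfolding qpoch_Suc_shift using p0 by (simp add: field_simps)
  have n1: "p * Q \<noteq> 1" using p1[of x] by (simp add: Q_def)
  have n2: "\<delta> * (p * Q) \<noteq> 1"
    using \<delta>[of "- int (Suc x)"] p0 Q0 x unfolding pw by (auto simp: field_simps)
  have n3: "\<delta> * (p * Q) \<noteq> P"
    using \<delta>[of "int m - int (Suc x)"] p0 by (auto simp: m P_def Q_def power_int_diff field_simps simp del: of_nat_Suc)
  have n4: "\<delta> * Q \<noteq> P"
    using \<delta>[of "int m - int x"] p0 by (auto simp: m P_def Q_def power_int_diff field_simps)
  define S where "S = qpoch (\<alpha> * p) p x * qpoch (inverse \<beta> * inverse \<delta> * (1 / Q)) p x *
     qpoch (\<beta> * p) p m * qpoch (\<alpha> * inverse \<delta> * p) p m / (qpoch p p x * qpoch p p m * E) *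
     \<beta> ^ x * p ^ (n * (n + 1) div 2 + x)"
  have w0: "weight p \<alpha> \<beta> \<delta> n x = S * (1 - inverse \<delta> * (P / Q))"
    by (simp add: weight_def pw Nx S_def E_def)
  have w1: "weight p \<alpha> \<beta> \<delta> (Suc n) (Suc x) = S *
     ((1 - \<alpha> * p * Q) * (1 - inverse \<beta> * inverse \<delta> * (1 / (p * Q)))
      / ((1 - p * Q) * (1 - inverse \<delta> * (1 / (p * Q))))
      * \<beta> * (p * p * P * Q) * (1 - inverse \<delta> * (P / (p * Q))))"
    unfolding weight_def pw Nx tri E' b S_def P_def[symmetric] power_add[of p _ "Suc (Suc n)"]
    unfolding qpoch_Suc
    by (simp add: m power_add P_def Q_def mult_ac)
  have "(1 - \<alpha> * p * Q) * (1 - inverse \<beta> * inverse \<delta> * (1 / (p * Q)))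
      / ((1 - p * Q) * (1 - inverse \<delta> * (1 / (p * Q))))
      * \<beta> * (p * p * P * Q) * (1 - inverse \<delta> * (P / (p * Q))) * R_sub p \<delta> n (int (Suc x)) =
     (1 - inverse \<delta> * (P / Q)) * L_super p \<alpha> \<beta> \<delta> (Suc n) (int x)"
  proof -
    have f: "1 - inverse \<delta> * (P / Q) = (\<delta> * Q - P) / (\<delta> * Q)"
      "1 - inverse \<delta> * (P / (p * Q)) = (\<delta> * (p * Q) - P) / (\<delta> * p * Q)"
      "1 - inverse \<delta> * (1 / (p * Q)) = - (1 - \<delta> * (p * Q)) / (\<delta> * p * Q)"
      "1 - inverse \<beta> * inverse \<delta> * (1 / (p * Q)) = - (1 - \<beta> * \<delta> * (p * Q)) / (\<beta> * \<delta> * p * Q)"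
      "1 - \<delta> * (p * Q / P) = - (\<delta> * (p * Q) - P) / P"
      "1 - \<delta> * (Q / P) = - (\<delta> * Q - P) / P" "1 - \<alpha> * p * Q = 1 - \<alpha> * (p * Q)"
      using p0 Q0 \<delta>0 \<beta>0 by (simp_all add: field_simps)
    define u1 u2 u3 u4 u5 u6 where u: "u1 = \<delta> * Q - P" "u2 = \<delta> * (p * Q) - P" "u3 = 1 - \<delta> * (p * Q)"
      "u4 = 1 - \<beta> * \<delta> * (p * Q)" "u5 = 1 - p * Q" "u6 = 1 - \<alpha> * (p * Q)"
    have "u1 \<noteq> 0" "u2 \<noteq> 0" "u3 \<noteq> 0" "u5 \<noteq> 0" using n1 n2 n3 n4 by (auto simp: u)
    then show ?thesis
      unfolding R_sub_def L_super_def pw f u[symmetric] using p0 Q0 \<delta>0 \<beta>0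
      by (simp add: divide_simps)
  qed
  then show ?thesis unfolding w0 w1 by (simp only: mult.assoc)
qed

section \<open>Reality of weights and entries under Hermitian symmetry\<close>

text \<open>Testing the form on the indicator function of \<open>x\<close> isolates one weight as a
  diagonal value, which Hermitian symmetry makes real.\<close>

lemma weight_real:
  assumes "hermitian_on (V M) (ip q \<alpha> \<beta> \<delta> M)" and "x \<le> M"
  shows "weight q \<alpha> \<beta> \<delta> M x \<in> \<real>"
proof -
  define f :: "int \<Rightarrow> complex" where "f = (\<lambda>y. if y = int x then 1 else 0)"
  have "f \<in> V M" using assms(2) by (auto simp: f_def V_def)
  then have "ip q \<alpha> \<beta> \<delta> M f f = cnj (ip q \<alpha> \<beta> \<delta> M f f)"
    using assms(1) unfolding hermitian_on_def by blast
  moreover have "ip q \<alpha> \<beta> \<delta> M f f = (\<Sum>y=0..M. if y = x then weight q \<alpha> \<beta> \<delta> M x else 0)"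
    unfolding ip_def by (intro sum.cong) (auto simp: f_def)
  then have "ip q \<alpha> \<beta> \<delta> M f f = weight q \<alpha> \<beta> \<delta> M x"
    using assms(2) by simp
  ultimately show ?thesis by (simp add: Reals_cnj_iff)
qed

text \<open>If the value \<open>r\<close> is real, clearing the denominator equates a real multiple
  of the nonreal \<open>z\<close> with a real number. Both must vanish, so \<open>(a, b)\<close> is
  \<open>r\<close> times \<open>(c, d)\<close>.\<close>

lemma mobius_real:
  fixes a b c d z :: complex
  assumes "(a * z + b) / (c * z + d) \<in> \<real>" "a \<in> \<real>" "b \<in> \<real>" "c \<in> \<real>" "d \<in> \<real>" "z \<notin> \<real>"
    and "c * z + d \<noteq> 0"
  shows "a * d = b * c"
proof -
  define r where "r = (a * z + b) / (c * z + d)"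
  have r: "r \<in> \<real>" using assms(1) by (simp add: r_def)
  have "(a - r * c) * z = r * d - b"
    using assms(7) by (simp add: r_def field_simps)
  moreover have R: "a - r * c \<in> \<real>" "r * d - b \<in> \<real>" using assms r by auto
  ultimately have "a - r * c = 0"
    using assms(6) by (metis Reals_divide nonzero_mult_div_cancel_left)
  moreover from this have "r * d - b = 0" using \<open>(a - r * c) * z = r * d - b\<close> by simp
  ultimately show ?thesis by (simp add: algebra_simps)
qed

text \<open>
  With \<open>a = \<alpha> p\<close> and \<open>b = \<beta> p\<close> the three quotients are \<open>L_diag\<close> and \<open>L_super\<close> for \<open>N = 1\<close>, \<open>x = 0\<close>, and
  \<open>L_super\<close> for \<open>N = 2\<close>, \<open>x = 1\<close>.  The first two add up to \<open>1 - a * b\<close>, so \<open>a * b\<close> is real.  Then the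
  third is a real linear fractional function of \<open>\<delta>\<close>, hence degenerate.
\<close>

lemma nonreal_delta_obstruction:
  fixes a b \<delta> p :: complex
  assumes \<delta>: "\<delta> \<notin> \<real>" and p: "p \<in> \<real>" "p \<noteq> 0" "p \<noteq> 1"
    and u: "(a - \<delta>) * (1 - b) / (1 - \<delta>) \<in> \<real>"
    and v: "(1 - a) * (1 - b * \<delta>) / (1 - \<delta>) \<in> \<real>"
    and w: "(1 - a * p) * (1 - b * p * \<delta>) / (1 - \<delta> * p) \<in> \<real>"
  shows "(a - \<delta>) * (1 - b) = 0"
proof -
  have d1: "1 - \<delta> \<noteq> 0" using \<delta> by auto
  have d2: "1 - \<delta> * p \<noteq> 0"
  proof
    assume "1 - \<delta> * p = 0"
    then have "\<delta> = 1 / p" using p by (simp add: field_simps)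
    then show False using \<delta> p by simp
  qed
  \<comment> \<open>The claim amounts to \<open>r = 1\<close>.\<close>
  define r where "r = 1 - (a - \<delta>) * (1 - b) / (1 - \<delta>)"
  have "(a - \<delta>) * (1 - b) + (1 - a) * (1 - b * \<delta>) = (1 - a * b) * (1 - \<delta>)"
    by (simp add: algebra_simps)
  then have "(a - \<delta>) * (1 - b) / (1 - \<delta>) + (1 - a) * (1 - b * \<delta>) / (1 - \<delta>) = 1 - a * b"
    using d1 by (simp add: add_divide_distrib[symmetric])
  then have "1 - a * b \<in> \<real>" using u v by (metis Reals_add)
  then have c: "a * b \<in> \<real>" using Reals_diff[OF Reals_1, of "1 - a * b"] by simp
  have r: "r \<in> \<real>" using u by (simp add: r_def)
  have "(1 - r) * (1 - \<delta>) = (a - \<delta>) * (1 - b)" using d1 by (simp add: r_def)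
  \<comment> \<open>This replaces \<open>a + b * \<delta>\<close>, where \<open>a\<close> and
    \<open>b\<close> may be nonreal, by an expression affine in \<delta> with real
    coefficients.\<close>
  then have ab: "a + b * \<delta> = \<delta> * r + (1 + a * b - r)"
    by (simp add: algebra_simps)
  have "(1 - a * p) * (1 - b * p * \<delta>) = 1 - p * (a + b * \<delta>) + p * p * (a * b) * \<delta>"
    by (simp add: algebra_simps)
  also have "\<dots> = (p * p * (a * b) - p * r) * \<delta> + (1 - p * (1 + a * b - r))"
    unfolding ab by (simp add: algebra_simps)
  finally have "((p * p * (a * b) - p * r) * \<delta> + (1 - p * (1 + a * b - r))) / (- p * \<delta> + 1) \<in> \<real>"
    using w by (simp add: mult.commute)
  then have "(p * p * (a * b) - p * r) * 1 = (1 - p * (1 + a * b - r)) * (- p)"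
    by (rule mobius_real) (use \<delta> p c r d2 in \<open>auto simp: mult.commute\<close>)
  \<comment> \<open>The product \<open>a * b\<close> cancels from the determinant condition.\<close>
  then have "p * (1 - p) * (1 - r) = 0" by (simp add: algebra_simps)
  then have "r = 1" using p by simp
  then show ?thesis using d1 by (simp add: r_def)
qed

lemma qpoch_nonzeroD: "qpoch a q k \<noteq> 0 \<Longrightarrow> i < k \<Longrightarrow> 1 - a * q ^ i \<noteq> 0"
  by (auto simp: qpoch_def)

lemma Reals_powi: "(z :: complex) \<in> \<real> \<Longrightarrow> z powi k \<in> \<real>"
  by (auto simp: power_int_def)

text \<open>A nonzero weight at an interior point makes nonzero the four numerator factors of
  \<open>L_diag\<close> and \<open>L_super\<close> for \<open>N = 1\<close> at \<open>0\<close>.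
  Starting from the weight \<open>1\<close> at \<open>M = 0\<close>, the relations between
  neighbouring weights make these two entries real, as well as \<open>L_super\<close> for
  \<open>N = 2\<close> at \<open>1\<close>. Then \<open>nonreal_delta_obstruction\<close> forces the
  numerator of \<open>L_diag\<close> to vanish, a contradiction.\<close>

lemma interior_weight_eq_0:
  fixes p :: complex
  assumes herm: "\<forall>M. hermitian_on (V M) (ip p \<alpha> \<beta> \<delta> M)"
    and p: "p \<in> \<real>" "p \<noteq> 0" and p1: "\<And>k. p ^ Suc k \<noteq> 1"
    and \<beta>0: "\<beta> \<noteq> 0" and \<delta>: "\<delta> \<notin> \<real>" and x: "0 < x" "x < N"
  shows "weight p \<alpha> \<beta> \<delta> N x = 0"
proof (rule ccontr)
  assume "weight p \<alpha> \<beta> \<delta> N x \<noteq> 0"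
  then have nz: "qpoch (\<alpha> * p) p x \<noteq> 0" "qpoch (inverse \<beta> * inverse \<delta> * p powi (- int x)) p x \<noteq> 0"
     "qpoch (\<beta> * p) p (N - x) \<noteq> 0" "qpoch (\<alpha> * inverse \<delta> * p) p (N - x) \<noteq> 0"
    by (auto simp: weight_def)
  have \<delta>0: "\<delta> \<noteq> 0" and \<delta>': "\<delta> \<noteq> p powi k" for k using \<delta> Reals_powi[OF p(1), of k] by auto
  \<comment> \<open>These are the factors of index \<open>0\<close>; the symbols are nonempty
    because \<open>0 < x\<close> and \<open>x < N\<close>.\<close>
  have n1: "1 - \<alpha> * p \<noteq> 0" "1 - \<beta> * p \<noteq> 0" "\<alpha> * p - \<delta> \<noteq> 0"
    using nz[THEN qpoch_nonzeroD, of 0] x \<delta>0 by (auto simp: field_simps)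
  obtain y where y: "x = Suc y" using x gr0_implies_Suc by blast
  have "p powi (- int x) * p ^ y = 1 / p"
    using p by (simp add: y power_int_minus del: of_nat_Suc) (simp add: field_simps)
  then have "1 - inverse \<beta> * inverse \<delta> * (1 / p) \<noteq> 0"
    using qpoch_nonzeroD[OF nz(2), of y] y by (simp only: mult.assoc) simp
  then have n2: "1 - \<beta> * \<delta> * p \<noteq> 0"
    using p \<beta>0 \<delta>0 by (auto simp: field_simps)
  have wt: "weight p \<alpha> \<beta> \<delta> M k \<in> \<real>" if "k \<le> M" for M k
    using weight_real[of M p \<alpha> \<beta> \<delta> k] herm that by auto
  have d1: "1 - \<delta> \<noteq> 0" using \<delta>'[of 0] by auto
  have w00: "weight p \<alpha> \<beta> \<delta> 0 0 = 1"
    using d1 \<delta>0 by (simp add: weight_def qpoch_def divide_simps)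
  \<comment> \<open>At \<open>x = 0\<close> the exponents \<open>x - n - 1\<close> and
    \<open>2 * x - n - 1\<close> agree, so the factors containing \<delta> cancel.\<close>
  have "R_diag p \<delta> 0 0 = - (1 - p powi (- 1))"
    using \<delta>'[of 1] p by (simp add: R_diag_def field_simps)
  then have "R_diag p \<delta> 0 0 \<in> \<real>" using p by (simp add: Reals_powi)
  then have "weight p \<alpha> \<beta> \<delta> 1 0 * R_diag p \<delta> 0 0 \<in> \<real>"
    using wt[of 0 1] by simp
  moreover have "weight p \<alpha> \<beta> \<delta> 1 0 * R_diag p \<delta> 0 0 = L_diag p \<alpha> \<beta> \<delta> 1 0"
    using weight_R_diag[of p \<delta> 0 0 \<alpha> \<beta>, OF p(2) p1 \<delta>0 \<delta>'] w00 by simp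
  ultimately have u: "L_diag p \<alpha> \<beta> \<delta> 1 0 \<in> \<real>" by simp
  \<comment> \<open>Likewise, at \<open>x = n + 1\<close> the exponents \<open>x\<close> and
    \<open>2 * x - n - 1\<close> agree.\<close>
  have Rs: "R_sub p \<delta> n (int n + 1) = p powi (- int n - 1) * (1 - p powi (int n + 1))" for n
    using \<delta>'[of "- int n - 1"] p
    by (simp add: R_sub_def) (auto simp: field_simps power_int_minus power_int_diff power_int_add)
  then have Rs_real: "R_sub p \<delta> n (int n + 1) \<in> \<real>" for n using p by (simp add: Reals_powi)
  have v_eq: "weight p \<alpha> \<beta> \<delta> 1 1 * R_sub p \<delta> 0 1 = L_super p \<alpha> \<beta> \<delta> 1 0"
    using weight_R_sub[of p \<beta> \<delta> 0 0 \<alpha>, OF p(2) p1 \<beta>0 \<delta>0 \<delta>'] w00 by simp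
  then have v: "L_super p \<alpha> \<beta> \<delta> 1 0 \<in> \<real>"
    using Reals_mult[OF wt[of 1 1] Rs_real[of 0]] by simp
  have L1: "L_super p \<alpha> \<beta> \<delta> 1 0 = (1 - \<alpha> * p) * (1 - \<beta> * p * \<delta>) / (1 - \<delta>)"
    by (simp add: L_super_def mult_ac)
  then have "L_super p \<alpha> \<beta> \<delta> 1 0 \<noteq> 0" using n1 n2 d1 by (simp add: mult_ac)
  \<comment> \<open>Division by this weight isolates \<open>L_super\<close> in the relation between
    \<open>M = 1\<close> and \<open>M = 2\<close>.\<close>
  then have w11: "weight p \<alpha> \<beta> \<delta> 1 1 \<noteq> 0" using v_eq by auto
  have "weight p \<alpha> \<beta> \<delta> 2 2 * R_sub p \<delta> 1 2 = weight p \<alpha> \<beta> \<delta> 1 1 * L_super p \<alpha> \<beta> \<delta> 2 1"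
    using weight_R_sub[of p \<beta> \<delta> 1 1 \<alpha>, OF p(2) p1 \<beta>0 \<delta>0 \<delta>'] by (simp add: numeral_2_eq_2)
  then have "L_super p \<alpha> \<beta> \<delta> 2 1 = weight p \<alpha> \<beta> \<delta> 2 2 * R_sub p \<delta> 1 2 / weight p \<alpha> \<beta> \<delta> 1 1"
    using w11 by (simp add: field_simps)
  then have w: "L_super p \<alpha> \<beta> \<delta> 2 1 \<in> \<real>"
    using wt[of 2 2] wt[of 1 1] Rs_real[of 1] by (simp add: Reals_divide)
  have L2: "L_super p \<alpha> \<beta> \<delta> 2 1 = (1 - \<alpha> * p * p) * (1 - \<beta> * p * p * \<delta>) / (1 - \<delta> * p)"
    by (simp add: L_super_def mult_ac power2_eq_square)
  have L0: "L_diag p \<alpha> \<beta> \<delta> 1 0 = (\<alpha> * p - \<delta>) * (1 - \<beta> * p) / (1 - \<delta>)"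
    using p d1 by (simp add: L_diag_def power_int_minus field_simps power2_eq_square)
  have "(\<alpha> * p - \<delta>) * (1 - \<beta> * p) = 0"
    by (rule nonreal_delta_obstruction[OF \<delta> p(1,2)])
      (use p1[of 0] u v w L0 L1 L2 in auto)
  then show False using n1 by simp
qed

text \<open>For real \<delta> both factors are real. Otherwise either the entry sits at an end of
  the range, where \<delta> cancels from it, or the weight sits at an interior point and
  vanishes.\<close>

lemma weight_R_real:
  fixes p :: complex
  assumes herm: "\<forall>M. hermitian_on (V M) (ip p \<alpha> \<beta> \<delta> M)"
    and p: "p \<in> \<real>" "p \<noteq> 0" and p1: "\<And>k. p ^ Suc k \<noteq> 1"
    and \<beta>0: "\<beta> \<noteq> 0" and x: "x \<le> n"
  shows "weight p \<alpha> \<beta> \<delta> (Suc n) x * R_diag p \<delta> n (int x) \<in> \<real>"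
    and "weight p \<alpha> \<beta> \<delta> (Suc n) (Suc x) * R_sub p \<delta> n (int (Suc x)) \<in> \<real>"
proof -
  have wt: "weight p \<alpha> \<beta> \<delta> (Suc n) k \<in> \<real>" if "k \<le> Suc n" for k
    using weight_real[of "Suc n" p \<alpha> \<beta> \<delta> k] herm that by auto
  have \<delta>: "\<delta> \<noteq> p powi k" if "\<delta> \<notin> \<real>" for k using that Reals_powi[OF p(1), of k] by auto
  show "weight p \<alpha> \<beta> \<delta> (Suc n) x * R_diag p \<delta> n (int x) \<in> \<real>"
  proof (cases "\<delta> \<in> \<real> \<or> x = 0")
    case True
    then have "R_diag p \<delta> n (int x) \<in> \<real>"
    proof (cases "\<delta> \<in> \<real>")
      case False
      then have "R_diag p \<delta> n (int x) = - (1 - p powi (- int n - 1))"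
        using True \<delta>[of "int n + 1"] p
        by (auto simp: R_diag_def power_int_diff power_int_minus power_int_add field_simps)
      then show ?thesis using p by (simp add: Reals_powi)
    qed (simp add: R_diag_def p Reals_powi Reals_divide)
    then show ?thesis using wt x by simp
  next
    case False
    then show ?thesis using interior_weight_eq_0[OF herm p p1 \<beta>0, of x "Suc n"] x by simp
  qed
  show "weight p \<alpha> \<beta> \<delta> (Suc n) (Suc x) * R_sub p \<delta> n (int (Suc x)) \<in> \<real>"
  proof (cases "\<delta> \<in> \<real> \<or> x = n")
    case True
    then have "R_sub p \<delta> n (int (Suc x)) \<in> \<real>"
    proof (cases "\<delta> \<in> \<real>")
      case False
      then have "R_sub p \<delta> n (int (Suc x)) = p powi (- int n - 1) * (1 - p powi (int n + 1))"
        using True \<delta>[of "- int n - 1"] p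
        by (simp add: R_sub_def) (auto simp: field_simps power_int_minus power_int_diff power_int_add)
      then show ?thesis using p by (simp add: Reals_powi)
    qed (simp add: R_sub_def p Reals_powi Reals_divide del: of_nat_Suc)
    then show ?thesis using wt x by (simp del: of_nat_Suc)
  next
    case False
    then show ?thesis using interior_weight_eq_0[OF herm p p1 \<beta>0, of "Suc x" "Suc n"] x by simp
  qed
qed

section \<open>Both scalar products as sums over the same points\<close>

text \<open>The sum is reindexed by the argument of \<open>f1\<close>; the terms lost at the two
  ends vanish because \<open>f1\<close> is zero at \<open>-1\<close> and
  \<open>n + 1\<close>.\<close>

lemma ip_R_op:
  assumes "f1 \<in> V n"
  shows "ip q \<alpha> \<beta> \<delta> (Suc n) (R_op q \<delta> n f1) f2 =
    (\<Sum>x=0..n. weight q \<alpha> \<beta> \<delta> (Suc n) x * R_diag q \<delta> n (int x) * f1 (int x) * cnj (f2 (int x)) +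
       weight q \<alpha> \<beta> \<delta> (Suc n) (Suc x) * R_sub q \<delta> n (int (Suc x)) * f1 (int x) * cnj (f2 (int x + 1)))"
proof -
  define D where "D x = weight q \<alpha> \<beta> \<delta> (Suc n) x * R_diag q \<delta> n (int x) * f1 (int x) * cnj (f2 (int x))" for x
  define S where "S x = weight q \<alpha> \<beta> \<delta> (Suc n) x * R_sub q \<delta> n (int x) * f1 (int x - 1) * cnj (f2 (int x))" for x
  have ends: "f1 (- 1) = 0" "f1 (int (Suc n)) = 0" using assms by (auto simp: V_def)
  have "ip q \<alpha> \<beta> \<delta> (Suc n) (R_op q \<delta> n f1) f2 = (\<Sum>x=0..Suc n. D x + S x)"
    unfolding ip_def by (intro sum.cong) (auto simp: R_op_eq D_def S_def algebra_simps)
  also have "\<dots> = (\<Sum>x=0..Suc n. D x) + (\<Sum>x=0..Suc n. S x)" by (rule sum.distrib)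
  also have "(\<Sum>x=0..Suc n. D x) = (\<Sum>x=0..n. D x)" using ends by (simp add: D_def)
  also have "(\<Sum>x=0..Suc n. S x) = (\<Sum>x=0..n. S (Suc x))"
    using ends by (subst sum.atLeast0_atMost_Suc_shift) (simp add: S_def)
  finally show ?thesis by (simp add: sum.distrib[symmetric] D_def S_def add.commute)
qed

text \<open>The parameters of the operator are kept separate from those of the weights, so that the
  expansion serves both the given and the conjugated parameters.\<close>

lemma ip_L_op:
  "ip q \<alpha> \<beta> \<delta> n f1 (L_op q \<alpha>' \<beta>' \<delta>' (Suc n) f2) =
    (\<Sum>x=0..n. weight q \<alpha> \<beta> \<delta> n x * cnj (L_diag q \<alpha>' \<beta>' \<delta>' (Suc n) (int x)) * f1 (int x) * cnj (f2 (int x)) +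
       weight q \<alpha> \<beta> \<delta> n x * cnj (L_super q \<alpha>' \<beta>' \<delta>' (Suc n) (int x)) * f1 (int x) * cnj (f2 (int x + 1)))"
  unfolding ip_def by (intro sum.cong) (auto simp: L_op_eq algebra_simps)

theorem proposition5p2:
  fixes q :: real and \<alpha> \<beta> \<delta> :: complex and N :: nat and f1 f2 :: "int \<Rightarrow> complex"
  assumes "0 < q" and "q < 1"
    and "\<beta> \<noteq> 0" and "\<delta> \<noteq> 0"
    and "\<forall>k\<in>{- int N..int N}. \<delta> \<noteq> complex_of_real q powi k"
    and "N \<ge> 1" and "f1 \<in> V (N - 1)" and "f2 \<in> V N"
  shows "((\<forall>M. hermitian_on (V M) (ip q \<alpha> \<beta> \<delta> M)) \<longrightarrow>
           ip q \<alpha> \<beta> \<delta> N (R_op q \<delta> (N - 1) f1) f2 =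
           ip q \<alpha> \<beta> \<delta> (N - 1) f1 (L_op q \<alpha> \<beta> \<delta> N f2)) \<and>
         ip q \<alpha> \<beta> \<delta> N (R_op q \<delta> (N - 1) f1) f2 =
           ip q \<alpha> \<beta> \<delta> (N - 1) f1 (L_op q (cnj \<alpha>) (cnj \<beta>) (cnj \<delta>) N f2)"
proof -
  obtain n where N: "N = Suc n" using \<open>N \<ge> 1\<close> by (cases N) auto
  define p where "p = complex_of_real q"
  have p: "p \<in> \<real>" "p \<noteq> 0" "cnj p = p" using \<open>0 < q\<close> by (simp_all add: p_def)
  have p1: "p ^ Suc k \<noteq> 1" for k
  proof -
    have "q ^ Suc k < 1" using assms by (intro power_Suc_less_one) auto
    then show ?thesis unfolding p_def by (metis less_irrefl of_real_eq_1_iff of_real_power)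
  qed
  have \<delta>: "\<delta> \<noteq> p powi k" if "- int n - 1 \<le> k" "k \<le> int n + 1" for k
    using assms(5) that by (auto simp: p_def N)
  have f1: "f1 \<in> V n" using assms(7) by (simp add: N)
  have diag: "weight p \<alpha> \<beta> \<delta> (Suc n) x * R_diag p \<delta> n (int x) =
        weight p \<alpha> \<beta> \<delta> n x * L_diag p \<alpha> \<beta> \<delta> (Suc n) (int x)"
    and sub: "weight p \<alpha> \<beta> \<delta> (Suc n) (Suc x) * R_sub p \<delta> n (int (Suc x)) =
        weight p \<alpha> \<beta> \<delta> n x * L_super p \<alpha> \<beta> \<delta> (Suc n) (int x)" if "x \<le> n" for x
    using that p(2) p1 \<open>\<beta> \<noteq> 0\<close> \<open>\<delta> \<noteq> 0\<close> \<delta> by (blast intro: weight_R_diag weight_R_sub)+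
  \<comment> \<open>Conjugated parameters undo the \<open>cnj\<close> on the entries, so the two
    sums agree term by term through \<open>diag\<close> and \<open>sub\<close>.\<close>
  have "ip p \<alpha> \<beta> \<delta> (Suc n) (R_op p \<delta> n f1) f2 =
      ip p \<alpha> \<beta> \<delta> n f1 (L_op p (cnj \<alpha>) (cnj \<beta>) (cnj \<delta>) (Suc n) f2)"
    unfolding ip_R_op[OF f1] ip_L_op
    by (intro sum.cong) (simp_all add: diag sub cnj_L_diag cnj_L_super p del: of_nat_Suc)
  moreover have "ip p \<alpha> \<beta> \<delta> (Suc n) (R_op p \<delta> n f1) f2 = ip p \<alpha> \<beta> \<delta> n f1 (L_op p \<alpha> \<beta> \<delta> (Suc n) f2)"
    if herm: "\<forall>M. hermitian_on (V M) (ip p \<alpha> \<beta> \<delta> M)"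
  proof -
    have wt: "weight p \<alpha> \<beta> \<delta> n x \<in> \<real>" if "x \<le> n" for x
      using weight_real[OF _ that] herm by blast
    \<comment> \<open>The product \<open>w * L\<close> is real, hence equal to its own conjugate,
      and since \<open>w\<close> is real the conjugation falls on \<open>L\<close> alone.\<close>
    have eq: "w * cnj L = w' * R" if "w' * R = w * L" "w' * R \<in> \<real>" "w \<in> \<real>" for w w' L R :: complex
      using that by (metis Reals_cnj_iff complex_cnj_mult)
    have "weight p \<alpha> \<beta> \<delta> n x * cnj (L_diag p \<alpha> \<beta> \<delta> (Suc n) (int x)) =
          weight p \<alpha> \<beta> \<delta> (Suc n) x * R_diag p \<delta> n (int x)"
      and "weight p \<alpha> \<beta> \<delta> n x * cnj (L_super p \<alpha> \<beta> \<delta> (Suc n) (int x)) =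
          weight p \<alpha> \<beta> \<delta> (Suc n) (Suc x) * R_sub p \<delta> n (int (Suc x))" if "x \<le> n" for x
      by (rule eq[OF diag[OF that] weight_R_real(1)[OF herm p(1,2) p1 \<open>\<beta> \<noteq> 0\<close> that] wt[OF that]],
          rule eq[OF sub[OF that] weight_R_real(2)[OF herm p(1,2) p1 \<open>\<beta> \<noteq> 0\<close> that] wt[OF that]])
    then show ?thesis
      unfolding ip_R_op[OF f1] ip_L_op by (intro sum.cong) (simp_all del: of_nat_Suc)
  qed
  ultimately show ?thesis by (simp add: N p_def)
qed

end
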